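(* Let $\nu\in\mathbb{N}$, let $\omega\in(1/2,1]^\nu$ be non-resonant, $\Lambda=\omega\cdot\mathbb{Z}^\nu\subseteq\mathbb{R}$, and let $p\in\{4,6\}$. If $s<(\nu-1)\big(\frac12-\frac1p\big)$, then the estimate $$\|e^{it\partial_x^2}R_Cf\|_{L^p_t([0,1],\mathcal{L}^p_x)}\lesssim C^s\|f\|_{\mathcal{L}^2_x}$$ fails; i.e. there is no constant $K$ such that $\|e^{it\partial_x^2}R_Cf\|_{L^p_t([0,1],\mathcal{L}^p_x)}\le KC^s\|f\|_{\mathcal{L}^2_x}$ for all dyadic $C\in2^{\mathbb{N}_0}$ and all trigonometric polynomials $f$ with frequencies in $\Lambda$.
   Context: Non-resonant means that $\omega_1,\dots,\omega_\nu$ are linearly independent over $\mathbb{Q}$. For $n\in\mathbb{Z}^\nu$ write $\langle n\rangle_\omega=n\cdot\omega$. For $1\le p<\infty$, $\|f\|^p_{\mathcal{L}^p_x(\mathbb{R})}=\lim_{L\to\infty}\frac1{2L}\int_{-L}^L|f|^pdx$ and $\|F\|^p_{L^p_t([0,1],\mathcal{L}^p_x)}=\int_0^1\|F(t)\|^p_{\mathcal{L}^p_x}dt$. For a trigonometric polynomial $f=\sum_{n\in\mathbb{Z}^\nu}a_ne^{i\langle n\rangle_\omega x}$ (finitely many $a_n\neq0$), $e^{it\partial_x^2}f=\sum_na_ne^{i(\langle n\rangle_\omega x-t\langle n\rangle_\omega^2)}$ and $R_Cf=\sum_n\chi_C(|n|)a_ne^{i\langle n\rangle_\omega x}$, where $\chi_1\in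 C_c^\infty(-2,2)$ is a fixed radially decreasing function with $\chi_1=1$ on $[-1,1]$ and $\chi_C(\xi)=\chi_1(|\xi|/C)-\chi_1(2|\xi|/C)$ for dyadic $C\ge2$. *)

theory Defs
  imports "HOL-Analysis.Analysis"
begin

definition nonresonant :: "real ^ 'n \<Rightarrow> bool" where
  "nonresonant \<omega> \<longleftrightarrow>
     (\<forall>q :: 'n \<Rightarrow> rat. (\<Sum>i\<in>UNIV. of_rat (q i) * \<omega> $ i) = 0 \<longrightarrow> (\<forall>i. q i = 0))"

definition freq :: "real ^ 'n \<Rightarrow> int ^ 'n \<Rightarrow> real" where
  "freq \<omega> n = (\<Sum>i\<in>UNIV. of_int (n $ i) * \<omega> $ i)"

text \<open>Euclidean length of a lattice point.\<close>
definition lattice_norm :: "int ^ 'n \<Rightarrow> real" where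
  "lattice_norm n = norm ((\<chi> i. of_int (n $ i)) :: real ^ 'n)"

text \<open>
  A trigonometric polynomial with frequencies \<open>freq \<omega> n\<close> is given by its finitely supported
  coefficient family \<open>a\<close>; for non-resonant \<open>\<omega>\<close> the family is determined by the function.
  The multipliers below therefore act on coefficient families.
\<close>
definition trig_poly :: "real ^ 'n \<Rightarrow> (int ^ 'n \<Rightarrow> complex) \<Rightarrow> real \<Rightarrow> complex" where
  "trig_poly \<omega> a x = (\<Sum>n | a n \<noteq> 0. a n * cis (freq \<omega> n * x))"

text \<open>The propagator \<open>exp (i t \<partial>\<^sub>x\<^sup>2)\<close>.\<close>
definition schroedinger :: "real ^ 'n \<Rightarrow> real \<Rightarrow> (int ^ 'n \<Rightarrow> complex) \<Rightarrow> int ^ 'n \<Rightarrow> complex" where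
  "schroedinger \<omega> t a n = cis (- (t * (freq \<omega> n)\<^sup>2)) * a n"

text \<open>
  The last clause is radial monotonicity; it makes the function even. The support condition
  implies that the support is compact.
\<close>
definition is_cutoff :: "(real \<Rightarrow> real) \<Rightarrow> bool" where
  "is_cutoff \<phi> \<longleftrightarrow>
     (\<forall>k x. (deriv ^^ k) \<phi> differentiable (at x)) \<and>
     closure {x. \<phi> x \<noteq> 0} \<subseteq> {-2<..<2} \<and>
     (\<forall>x\<in>{-1..1}. \<phi> x = 1) \<and>
     (\<forall>x y. \<bar>x\<bar> \<le> \<bar>y\<bar> \<longrightarrow> \<phi> y \<le> \<phi> x)"

definition dyadic_cutoff :: "(real \<Rightarrow> real) \<Rightarrow> real \<Rightarrow> real \<Rightarrow> real" where
  "dyadic_cutoff \<phi> C \<xi> = (if C = 1 then \<phi> \<xi> else \<phi> (\<bar>\<xi>\<bar> / C) - \<phi> (2 * \<bar>\<xi>\<bar> / C))"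

definition dyadic_proj ::
    "(real \<Rightarrow> real) \<Rightarrow> real \<Rightarrow> (int ^ 'n \<Rightarrow> complex) \<Rightarrow> int ^ 'n \<Rightarrow> complex" where
  "dyadic_proj \<phi> C a n = of_real (dyadic_cutoff \<phi> C (lattice_norm n)) * a n"

definition mean_Lp_norm :: "real \<Rightarrow> (real \<Rightarrow> complex) \<Rightarrow> real" where
  "mean_Lp_norm p f =
     (Lim at_top (\<lambda>L. 1 / (2 * L) * integral {-L..L} (\<lambda>x. norm (f x) powr p))) powr (1 / p)"

definition spacetime_norm :: "real \<Rightarrow> (real \<Rightarrow> real \<Rightarrow> complex) \<Rightarrow> real" where
  "spacetime_norm p F = (integral {0..1} (\<lambda>t. mean_Lp_norm p (F t) powr p)) powr (1 / p)"

end

theory Submission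
  imports Defs
begin

text \<open>
  Fix a coordinate \<open>i0\<close>. Over every point of a \<open>(\<nu> - 1)\<close>-dimensional lattice cube of side \<open>M\<close>, with
  \<open>M\<close> a small multiple of \<open>C\<close>, there is a lattice point whose frequency lies in a fixed interval of
  length at most \<open>1\<close>; moving that interval puts all these points where the cutoff equals \<open>1\<close>. Let \<open>A\<close> be
  the resulting set, of cardinality \<open>(M + 1)\<^sup>\<nu>\<^sup>-\<^sup>1\<close>, and \<open>f\<close> the exponential sum over \<open>A\<close>.
  For \<open>p = 2m\<close>, the mean of \<open>\<bar>exp (i t \<partial>\<^sub>x\<^sup>2) f\<bar>\<^sup>p\<close> is by Parseval the sum of the squared moduli of the
  coefficients of the \<open>m\<close>-th power. After a Galilean recentring all phases are at most \<open>m / 4\<close> for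
  \<open>t \<in> [0, 1]\<close>, so nothing cancels, and Cauchy--Schwarz bounds this sum below by a multiple of
  \<open>\<bar>A\<bar>\<^sup>2\<^sup>m / \<bar>A + \<dots> + A\<bar>\<close>, where the sumset has size \<open>O(\<bar>A\<bar>)\<close>. Hence the ratio of norms is at
  least a multiple of \<open>\<bar>A\<bar>\<close> to the power \<open>1/2 - 1/p\<close>.
\<close>

section \<open>Means of exponential sums over the real line and Parseval's identity\<close>

lemma prod_cis: "(\<Prod>i\<in>I. cis (f i)) = cis (\<Sum>i\<in>I. f i)"
  by (induction I rule: infinite_finite_induct) (auto simp: cis_mult)

text \<open>Orthogonality of characters: for nonzero \<open>l\<close> the antiderivative is bounded
  by \<open>1 / \<bar>l\<bar>\<close>, so division by \<open>2 * L\<close> sends the mean to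
  0.\<close>

lemma tendsto_mean_cis:
  "((\<lambda>L. complex_of_real (1 / (2 * L)) * integral {-L..L} (\<lambda>x. cis (l * x)))
     \<longlongrightarrow> (if l = 0 then 1 else 0)) at_top"
proof (cases "l = 0")
  case True
  have "eventually (\<lambda>L. complex_of_real (1 / (2 * L)) * integral {-L..L} (\<lambda>x. cis (l * x)) = 1) at_top"
    using eventually_gt_at_top[of 0]
  proof eventually_elim
    case (elim L)
    then show ?case by (simp add: True scaleR_conv_of_real)
  qed
  then show ?thesis using True by (simp add: tendsto_eventually)
next
  case False
  have bound: "norm (complex_of_real (1 / (2 * L)) * integral {-L..L} (\<lambda>x. cis (l * x))) \<le> (1 / \<bar>l\<bar>) / L"
    if L: "L > 0" for L :: real
  proof -
    have "((\<lambda>x. cis (l * x)) has_integral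
            (cis (l * L) / (\<i> * l) - cis (l * (-L)) / (\<i> * l))) {-L..L}"
    proof (rule fundamental_theorem_of_calculus)
      show "-L \<le> L" using L by simp
      fix x assume "x \<in> {-L..L}"
      have "((\<lambda>x. exp (\<i> * complex_of_real l * of_real x) / (\<i> * l)) has_vector_derivative
              exp (\<i> * complex_of_real l * of_real x)) (at x within {-L..L})"
        using False
        by (auto intro!: derivative_eq_intros has_vector_derivative_real_field)
      then show "((\<lambda>x. cis (l * x) / (\<i> * l)) has_vector_derivative cis (l * x)) (at x within {-L..L})"
        by (simp add: cis_conv_exp mult.assoc)
    qed
    then have eq: "integral {-L..L} (\<lambda>x. cis (l * x)) = cis (l * L) / (\<i> * l) - cis (l * (-L)) / (\<i> * l)"
      by blast
    have "norm (integral {-L..L} (\<lambda>x. cis (l * x))) \<le> norm (cis (l * L) / (\<i> * l)) + norm (cis (l * (-L)) / (\<i> * l))"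
      unfolding eq by (rule norm_triangle_ineq4)
    also have "\<dots> = 2 / \<bar>l\<bar>" by (simp add: norm_mult norm_divide)
    finally show ?thesis using L by (simp add: norm_mult norm_divide field_simps)
  qed
  have "((\<lambda>L. complex_of_real (1 / (2 * L)) * integral {-L..L} (\<lambda>x. cis (l * x))) \<longlongrightarrow> 0) at_top"
  proof (rule Lim_null_comparison)
    show "\<forall>\<^sub>F L in at_top. norm (complex_of_real (1 / (2 * L)) * integral {-L..L} (\<lambda>x. cis (l * x))) \<le> (1 / \<bar>l\<bar>) / L"
      using eventually_gt_at_top[of 0] by eventually_elim (rule bound)
    show "((\<lambda>L. (1 / \<bar>l\<bar>) / L) \<longlongrightarrow> 0) at_top"
      by (intro tendsto_divide_0[OF tendsto_const] filterlim_at_top_imp_at_infinity filterlim_ident)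
  qed
  then show ?thesis using False by simp
qed

text \<open>Parseval for the mean: once the square is expanded, only the diagonal pairs survive the
  limit, because the elements of \<open>\<Lambda>\<close> are distinct frequencies.\<close>

lemma tendsto_mean_norm_square:
  fixes b :: "real \<Rightarrow> complex"
  assumes fin: "finite \<Lambda>"
  shows "((\<lambda>L. 1 / (2 * L) * integral {-L..L} (\<lambda>x. (norm (\<Sum>l\<in>\<Lambda>. b l * cis (l * x)))\<^sup>2))
           \<longlongrightarrow> (\<Sum>l\<in>\<Lambda>. (norm (b l))\<^sup>2)) at_top"
proof -
  define g where "g x = (\<Sum>l\<in>\<Lambda>. b l * cis (l * x))" for x
  have expand: "complex_of_real ((norm (g x))\<^sup>2) =
      (\<Sum>l\<in>\<Lambda>. \<Sum>k\<in>\<Lambda>. (b l * cnj (b k)) * cis ((l - k) * x))" for x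
  proof -
    have "complex_of_real ((norm (g x))\<^sup>2) = g x * cnj (g x)"
      by (rule complex_norm_square)
    also have "\<dots> = (\<Sum>l\<in>\<Lambda>. \<Sum>k\<in>\<Lambda>. (b l * cis (l * x)) * cnj (b k * cis (k * x)))"
      by (simp add: g_def sum_product cnj_sum)
    also have "\<dots> = (\<Sum>l\<in>\<Lambda>. \<Sum>k\<in>\<Lambda>. (b l * cnj (b k)) * cis ((l - k) * x))"
      by (intro sum.cong refl) (simp add: cis_cnj cis_mult left_diff_distrib)
    finally show ?thesis .
  qed
  have mean: "complex_of_real (1 / (2 * L) * integral {-L..L} (\<lambda>x. (norm (g x))\<^sup>2)) =
     (\<Sum>l\<in>\<Lambda>. \<Sum>k\<in>\<Lambda>. (b l * cnj (b k)) *
        (complex_of_real (1 / (2 * L)) * integral {-L..L} (\<lambda>x. cis ((l - k) * x))))" for L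
  proof -
    have int: "(\<lambda>x. (norm (g x))\<^sup>2) integrable_on {-L..L}"
      unfolding g_def by (intro integrable_continuous_interval continuous_intros)
    have "complex_of_real (integral {-L..L} (\<lambda>x. (norm (g x))\<^sup>2)) =
        integral {-L..L} (\<lambda>x. complex_of_real ((norm (g x))\<^sup>2))"
      using integral_linear[OF int bounded_linear_of_real[where 'a=complex]] by (simp add: o_def)
    also have "\<dots> = (\<Sum>l\<in>\<Lambda>. \<Sum>k\<in>\<Lambda>. (b l * cnj (b k)) * integral {-L..L} (\<lambda>x. cis ((l - k) * x)))"
      unfolding expand
      by (subst integral_sum, use fin in \<open>auto intro!: integrable_continuous_interval continuous_intros\<close>)+
    finally show ?thesis by (simp add: sum_distrib_left sum_divide_distrib mult_ac)
  qed
  have "((\<lambda>L. \<Sum>l\<in>\<Lambda>. \<Sum>k\<in>\<Lambda>. (b l * cnj (b k)) *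
          (complex_of_real (1 / (2 * L)) * integral {-L..L} (\<lambda>x. cis ((l - k) * x))))
       \<longlongrightarrow> (\<Sum>l\<in>\<Lambda>. \<Sum>k\<in>\<Lambda>. (b l * cnj (b k)) * (if l - k = 0 then 1 else 0))) at_top"
    by (intro tendsto_sum tendsto_mult tendsto_const tendsto_mean_cis)
  also have "(\<Sum>l\<in>\<Lambda>. \<Sum>k\<in>\<Lambda>. (b l * cnj (b k)) * (if l - k = 0 then 1 else 0)) =
       complex_of_real (\<Sum>l\<in>\<Lambda>. (norm (b l))\<^sup>2)"
    using fin by (simp add: if_distrib[of "\<lambda>x. _ * x"] complex_norm_square del: of_real_power cong: if_cong)
  finally have "((\<lambda>L. complex_of_real (1 / (2 * L) * integral {-L..L} (\<lambda>x. (norm (g x))\<^sup>2)))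
       \<longlongrightarrow> complex_of_real (\<Sum>l\<in>\<Lambda>. (norm (b l))\<^sup>2)) at_top"
    unfolding mean .
  then show ?thesis unfolding g_def tendsto_of_real_iff .
qed

text \<open>An even exponent makes the norm algebraic, through the squared modulus of
  \<open>f x ^ m\<close>. As \<open>\<mu>\<close> may repeat values, terms of equal frequency are
  collected before Parseval applies.\<close>

lemma mean_Lp_norm_even_power:
  fixes \<beta> :: "'b \<Rightarrow> complex" and \<mu> :: "'b \<Rightarrow> real"
  assumes "finite T" "m \<noteq> 0" and f: "\<And>x. f x ^ m = (\<Sum>\<tau>\<in>T. \<beta> \<tau> * cis (\<mu> \<tau> * x))"
  shows "mean_Lp_norm (2 * real m) f powr (2 * real m) =
           (\<Sum>l\<in>\<mu> ` T. (norm (\<Sum>\<tau>\<in>{\<tau>\<in>T. \<mu> \<tau> = l}. \<beta> \<tau>))\<^sup>2)"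
proof -
  define b where "b l = (\<Sum>\<tau>\<in>{\<tau>\<in>T. \<mu> \<tau> = l}. \<beta> \<tau>)" for l
  have "f x ^ m = (\<Sum>l\<in>\<mu> ` T. b l * cis (l * x))" for x
  proof -
    have "f x ^ m = (\<Sum>l\<in>\<mu> ` T. \<Sum>\<tau>\<in>{\<tau>\<in>T. \<mu> \<tau> = l}. \<beta> \<tau> * cis (\<mu> \<tau> * x))"
      unfolding f by (rule sum.image_gen[OF \<open>finite T\<close>])
    also have "\<dots> = (\<Sum>l\<in>\<mu> ` T. b l * cis (l * x))"
      unfolding b_def sum_distrib_right by (intro sum.cong) auto
    finally show ?thesis .
  qed
  \<comment> \<open>At a zero of \<open>f\<close> this uses \<open>m \<noteq> 0\<close>, because
    \<open>0 powr y\<close> is 0 while \<open>0 ^ 0\<close> is 1.\<close>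
  moreover have "norm (f x) powr (2 * real m) = (norm (f x ^ m))\<^sup>2" for x
    using powr_realpow'[of "norm (f x)" "2 * m"] \<open>m \<noteq> 0\<close>
    by (simp add: norm_power mult.commute flip: power_mult)
  ultimately have "((\<lambda>L. 1 / (2 * L) * integral {-L..L} (\<lambda>x. norm (f x) powr (2 * real m)))
           \<longlongrightarrow> (\<Sum>l\<in>\<mu> ` T. (norm (b l))\<^sup>2)) at_top"
    using tendsto_mean_norm_square[of "\<mu> ` T" b] \<open>finite T\<close> by simp
  \<comment> \<open>\<open>Lim\<close> is a definite description, so its value is determined by the
    convergence just shown.\<close>
  then have "Lim at_top (\<lambda>L. 1 / (2 * L) * integral {-L..L} (\<lambda>x. norm (f x) powr (2 * real m)))
      = (\<Sum>l\<in>\<mu> ` T. (norm (b l))\<^sup>2)"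
    by (intro tendsto_Lim) auto
  then show ?thesis
    using \<open>m \<noteq> 0\<close> by (simp add: mean_Lp_norm_def b_def powr_powr sum_nonneg)
qed

section \<open>Exponential sums without cancellation\<close>

lemma cos_ge_half:
  fixes x :: real
  assumes "\<bar>x\<bar> \<le> 3 / 4"
  shows "cos x \<ge> 1 / 2"
proof -
  have "(sin (x / 2))\<^sup>2 \<le> (x / 2)\<^sup>2"
    using abs_sin_x_le_abs_x[of "x / 2"] by (simp only: abs_le_square_iff)
  moreover have "x\<^sup>2 \<le> (3 / 4)\<^sup>2" using assms abs_le_square_iff[of x "3 / 4"] by simp
  moreover have "cos x = 1 - 2 * (sin (x / 2))\<^sup>2"
    using cos_double_sin[of "x / 2"] by simp
  ultimately show ?thesis by (simp add: power2_eq_square)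
qed

text \<open>Multiplication by \<open>cis (-c)\<close> keeps the norm and centres the phases at 0,
  where every real part is at least 1/2.\<close>

lemma norm_sum_cis_ge:
  assumes "\<And>\<tau>. \<tau> \<in> T \<Longrightarrow> \<bar>\<theta> \<tau> - c\<bar> \<le> 3 / 4"
  shows "norm (\<Sum>\<tau>\<in>T. cis (\<theta> \<tau>)) \<ge> card T / 2"
proof -
  have "card T / 2 = (\<Sum>\<tau>\<in>T. 1 / 2 :: real)" by simp
  also have "\<dots> \<le> (\<Sum>\<tau>\<in>T. cos (\<theta> \<tau> - c))"
    by (intro sum_mono cos_ge_half assms)
  also have "\<dots> = Re ((\<Sum>\<tau>\<in>T. cis (\<theta> \<tau>)) * cis (-c))"
    by (simp add: sum_distrib_right cis_mult)
  also have "\<dots> \<le> norm ((\<Sum>\<tau>\<in>T. cis (\<theta> \<tau>)) * cis (-c))" by (rule complex_Re_le_cmod)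
  finally show ?thesis by (simp add: norm_mult)
qed

lemma trig_poly_superset:
  assumes "finite A" "\<And>n. n \<notin> A \<Longrightarrow> a n = 0"
  shows "trig_poly \<omega> a x = (\<Sum>n\<in>A. a n * cis (freq \<omega> n * x))"
  unfolding trig_poly_def using assms by (intro sum.mono_neutral_left) auto

lemma trig_poly_schroedinger_power:
  assumes "finite A"
  shows "trig_poly \<omega> (schroedinger \<omega> t (\<lambda>n. of_bool (n \<in> A))) x ^ m =
    (\<Sum>g\<in>PiE {..<m} (\<lambda>_. A). cis (- t * (\<Sum>i<m. (freq \<omega> (g i))\<^sup>2)) * cis ((\<Sum>i<m. freq \<omega> (g i)) * x))"
proof -
  have "trig_poly \<omega> (schroedinger \<omega> t (\<lambda>n. of_bool (n \<in> A))) x =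
      (\<Sum>n\<in>A. cis (- t * (freq \<omega> n)\<^sup>2) * cis (freq \<omega> n * x))"
    using assms by (subst trig_poly_superset[of A]) (auto simp: schroedinger_def)
  then have "trig_poly \<omega> (schroedinger \<omega> t (\<lambda>n. of_bool (n \<in> A))) x ^ m =
      (\<Prod>i<m. \<Sum>n\<in>A. cis (- t * (freq \<omega> n)\<^sup>2) * cis (freq \<omega> n * x))"
    by simp
  also have "\<dots> = (\<Sum>g\<in>PiE {..<m} (\<lambda>_. A). \<Prod>i<m. cis (- t * (freq \<omega> (g i))\<^sup>2) * cis (freq \<omega> (g i) * x))"
    using assms by (subst prod_sum_PiE) auto
  finally show ?thesis
    by (simp add: prod.distrib prod_cis sum_distrib_left sum_distrib_right)
qed

text \<open>The additive structure of \<open>A\<close> enters only through the size of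
  \<open>S\<close>, a set containing all \<open>m\<close>-fold sums of frequencies. The 1/4 is the
  square of the 1/2 in \<open>norm_sum_cis_ge\<close>, and \<open>m \<le> 3\<close> keeps the
  recentred phases within 3/4.\<close>

lemma spacetime_norm_lower:
  fixes A :: "(int ^ 'n) set"
  assumes fin: "finite A" and m: "m \<noteq> 0" "m \<le> 3"
    and near: "\<And>n. n \<in> A \<Longrightarrow> \<bar>freq \<omega> n - \<kappa>\<bar> \<le> 1 / 2"
    and S: "finite S" "\<And>g. g \<in> PiE {..<m} (\<lambda>_. A) \<Longrightarrow> (\<Sum>i<m. freq \<omega> (g i)) \<in> S"
  shows "real (card A) ^ (2 * m) / 4 \<le>
     real (card S) *
     spacetime_norm (2 * real m) (\<lambda>t. trig_poly \<omega> (schroedinger \<omega> t (\<lambda>n. of_bool (n \<in> A)))) powr (2 * real m)"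
proof -
  define T where "T = PiE {..<m} (\<lambda>_. A)"
  define \<mu> where "\<mu> g = (\<Sum>i<m. freq \<omega> (g i))" for g :: "nat \<Rightarrow> int ^ 'n"
  define q where "q g = (\<Sum>i<m. (freq \<omega> (g i))\<^sup>2)" for g :: "nat \<Rightarrow> int ^ 'n"
  define G where "G t = (\<Sum>l\<in>\<mu> ` T. (norm (\<Sum>g\<in>{g\<in>T. \<mu> g = l}. cis (- t * q g)))\<^sup>2)" for t
  have finT: "finite T" unfolding T_def by (intro finite_PiE fin) auto
  have mean: "mean_Lp_norm (2 * real m) (trig_poly \<omega> (schroedinger \<omega> t (\<lambda>n. of_bool (n \<in> A)))) powr (2 * real m) = G t" for t
    unfolding G_def
    by (rule mean_Lp_norm_even_power[OF finT m(1)])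
       (simp add: trig_poly_schroedinger_power[OF fin] T_def \<mu>_def q_def)
  have cardT: "real (card T) = real (card A) ^ m" unfolding T_def by (simp add: card_PiE)
  have lower: "real (card A) ^ (2 * m) / 4 \<le> real (card S) * G t" if t: "t \<in> {0..1}" for t
  proof -
    have term_ge: "real (card {g\<in>T. \<mu> g = l}) / 2 \<le> norm (\<Sum>g\<in>{g\<in>T. \<mu> g = l}. cis (- t * q g))" for l
    proof (rule norm_sum_cis_ge)
      fix g assume g: "g \<in> {g\<in>T. \<mu> g = l}"
      \<comment> \<open>Galilean invariance: recentring the frequencies at \<open>\<kappa>\<close> changes the phase only by a
        quantity that depends on \<open>g\<close> through the total frequency \<open>l\<close>.\<close>
      have "(\<Sum>i<m. (freq \<omega> (g i) - \<kappa>)\<^sup>2) = q g - 2 * \<kappa> * \<mu> g + m * \<kappa>\<^sup>2"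
        by (simp add: q_def \<mu>_def power2_diff sum.distrib sum_subtractf sum_distrib_left mult_ac)
      then have recentre: "q g = (\<Sum>i<m. (freq \<omega> (g i) - \<kappa>)\<^sup>2) + 2 * \<kappa> * \<mu> g - m * \<kappa>\<^sup>2" by simp
      have eq: "- t * q g - (- t * (2 * \<kappa> * l - m * \<kappa>\<^sup>2)) = - t * (\<Sum>i<m. (freq \<omega> (g i) - \<kappa>)\<^sup>2)"
        using g unfolding recentre by (simp add: algebra_simps)
      have "(freq \<omega> (g i) - \<kappa>)\<^sup>2 \<le> 1 / 4" if "i < m" for i
        using near[of "g i"] g that abs_le_square_iff[of "freq \<omega> (g i) - \<kappa>" "1 / 2"]
        by (auto simp: T_def power2_eq_square)
      then have "(\<Sum>i<m. (freq \<omega> (g i) - \<kappa>)\<^sup>2) \<le> (\<Sum>i<m. 1 / 4)" by (intro sum_mono) auto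
      also have "\<dots> \<le> 3 / 4" using m by simp
      finally have "t * (\<Sum>i<m. (freq \<omega> (g i) - \<kappa>)\<^sup>2) \<le> 1 * (3 / 4)"
        using t by (intro mult_mono) (auto simp: sum_nonneg)
      moreover have "0 \<le> t * (\<Sum>i<m. (freq \<omega> (g i) - \<kappa>)\<^sup>2)"
        using t by (simp add: sum_nonneg)
      ultimately show "\<bar>- t * q g - (- t * (2 * \<kappa> * l - m * \<kappa>\<^sup>2))\<bar> \<le> 3 / 4"
        unfolding eq by simp
    qed
    \<comment> \<open>Counting tuples by total frequency, then Cauchy--Schwarz over the distinct
      totals, brings in the size of the sumset.\<close>
    have "real (card T) / 2 = (\<Sum>l\<in>\<mu> ` T. real (card {g\<in>T. \<mu> g = l}) / 2)"
      using sum.image_gen[OF finT, of "\<lambda>_. 1 :: real" \<mu>] by (simp add: sum_divide_distrib)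
    also have "\<dots> \<le> (\<Sum>l\<in>\<mu> ` T. norm (\<Sum>g\<in>{g\<in>T. \<mu> g = l}. cis (- t * q g)))"
      by (intro sum_mono term_ge)
    finally have "(real (card T) / 2)\<^sup>2 \<le> (\<Sum>l\<in>\<mu> ` T. norm (\<Sum>g\<in>{g\<in>T. \<mu> g = l}. cis (- t * q g)))\<^sup>2"
      by (intro power_mono) auto
    also have "\<dots> \<le> G t * real (card (\<mu> ` T))"
      unfolding G_def by (rule sum_squared_le_sum_of_squares)
    also have "\<dots> \<le> G t * real (card S)"
    proof (intro mult_left_mono of_nat_mono card_mono)
      show "\<mu> ` T \<subseteq> S" using S(2) by (auto simp: T_def \<mu>_def)
      show "0 \<le> G t" by (simp add: G_def sum_nonneg)
    qed (use S in auto)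
    finally show ?thesis
      by (simp add: cardT power_divide mult.commute flip: power_mult)
  qed
  \<comment> \<open>Integrability matters here: \<open>integral\<close> defaults to 0 otherwise,
    which would void the lower bound.\<close>
  have "continuous_on {0..1} G" unfolding G_def by (intro continuous_intros)
  then have int: "G integrable_on {0..1}" by (rule integrable_continuous_interval)
  have "real (card A) ^ (2 * m) / 4 = integral {0..1} (\<lambda>t::real. real (card A) ^ (2 * m) / 4)" by simp
  also have "\<dots> \<le> integral {0..1} (\<lambda>t. real (card S) * G t)"
  proof (rule integral_le)
    show "(\<lambda>t. real (card S) * G t) integrable_on {0..1}"
      using integrable_on_cmult_left[OF int, of "real (card S)"] by simp
  qed (use lower in auto)
  also have "\<dots> = real (card S) * integral {0..1} G" by simp
  \<comment> \<open>Nonnegativity lets the power \<open>2 * real m\<close> undo the outer root in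
    \<open>spacetime_norm\<close>.\<close>
  also have "integral {0..1} G \<ge> 0"
    by (intro integral_nonneg int) (simp add: G_def sum_nonneg)
  then have "integral {0..1} G =
      spacetime_norm (2 * real m) (\<lambda>t. trig_poly \<omega> (schroedinger \<omega> t (\<lambda>n. of_bool (n \<in> A)))) powr (2 * real m)"
    using m by (simp add: spacetime_norm_def mean powr_powr)
  finally show ?thesis .
qed

section \<open>The frequency map and the quadratic mean\<close>

lemma freq_add: "freq \<omega> (u + v) = freq \<omega> u + freq \<omega> v"
  by (simp add: freq_def ring_distribs sum.distrib)

lemma freq_sum: "freq \<omega> (\<Sum>i\<in>I. u i) = (\<Sum>i\<in>I. freq \<omega> (u i))"
  by (induction I rule: infinite_finite_induct) (auto simp: freq_add, auto simp: freq_def)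

lemma freq_axis: "freq \<omega> (axis i k) = of_int k * \<omega> $ i"
  by (simp add: freq_def axis_def if_distrib[of "\<lambda>x. of_int x * _"] cong: if_cong)

text \<open>Two lattice points of equal frequency differ by an integer relation among the entries of
  \<open>\<omega>\<close>.\<close>

lemma inj_freq:
  assumes "nonresonant \<omega>"
  shows "inj (freq \<omega>)"
proof (rule injI)
  fix n n' assume "freq \<omega> n = freq \<omega> n'"
  then have "(\<Sum>i\<in>UNIV. of_rat (of_int (n $ i - n' $ i)) * \<omega> $ i) = 0"
    by (simp add: freq_def of_rat_diff left_diff_distrib sum_subtractf)
  then have "(of_int (n $ i - n' $ i) :: rat) = 0" for i
    using assms unfolding nonresonant_def by (elim allE[of _ "\<lambda>i. of_int (n $ i - n' $ i)"]) blast
  then show "n = n'" by (simp add: vec_eq_iff)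
qed

text \<open>The case \<open>m = 1\<close> of \<open>mean_Lp_norm_even_power\<close>; injectivity of
  \<open>freq \<omega>\<close> makes every fibre a singleton.\<close>

lemma mean_L2_norm_indicator:
  assumes "nonresonant \<omega>" "finite A"
  shows "mean_Lp_norm 2 (trig_poly \<omega> (\<lambda>n. of_bool (n \<in> A))) powr 2 = card A"
proof -
  have "mean_Lp_norm 2 (trig_poly \<omega> (\<lambda>n. of_bool (n \<in> A))) powr 2 =
      (\<Sum>l\<in>freq \<omega> ` A. (norm (\<Sum>n\<in>{n\<in>A. freq \<omega> n = l}. 1 :: complex))\<^sup>2)"
    using mean_Lp_norm_even_power[of A 1 "trig_poly \<omega> (\<lambda>n. of_bool (n \<in> A))" "\<lambda>_. 1" "freq \<omega>"]
    by (simp add: assms trig_poly_superset[OF assms(2)])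
  also have "\<dots> = (\<Sum>n\<in>A. 1)"
  proof (subst sum.reindex)
    show "inj_on (freq \<omega>) A" using inj_freq[OF assms(1)] by (rule inj_on_subset) simp
    have "{n' \<in> A. freq \<omega> n' = freq \<omega> n} = {n}" if "n \<in> A" for n
      using inj_freq[OF assms(1)] that by (auto dest: injD)
    then show "(\<Sum>n\<in>A. ((\<lambda>l. (norm (\<Sum>n\<in>{n\<in>A. freq \<omega> n = l}. 1 :: complex))\<^sup>2) \<circ> freq \<omega>) n) = (\<Sum>n\<in>A. 1)"
      by (intro sum.cong) auto
  qed
  finally show ?thesis by simp
qed

section \<open>The shell on which the dyadic cutoff equals 1\<close>

text \<open>The support is closed and avoids 2, hence avoids a neighbourhood of 2. The gap
  \<open>\<epsilon>\<close> later gives a shell of fixed relative thickness.\<close>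

lemma is_cutoff_vanishes_near_2:
  assumes "is_cutoff \<phi>"
  obtains \<epsilon> where "\<epsilon> > 0" "\<And>x. x \<ge> 2 - \<epsilon> \<Longrightarrow> \<phi> x = 0"
proof -
  define U where "U = - closure {x. \<phi> x \<noteq> 0}"
  have sub: "closure {x. \<phi> x \<noteq> 0} \<subseteq> {-2<..<2}" using assms by (simp add: is_cutoff_def)
  have "open U" "2 \<in> U" using sub by (auto simp: U_def)
  then obtain e where e: "e > 0" "ball 2 e \<subseteq> U" unfolding open_contains_ball by blast
  have zero: "\<phi> x = 0" if "x \<in> U" for x
    using that closure_subset[of "{x. \<phi> x \<noteq> 0}"] by (auto simp: U_def)
  have "\<phi> x = 0" if "x \<ge> 2 - e / 2" for x
  proof (cases "x < 2")
    case True
    then have "x \<in> ball 2 e" using that e(1) by (simp add: dist_real_def)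
    then show ?thesis using e zero by blast
  next
    case False
    then have "x \<in> U" using sub by (auto simp: U_def)
    then show ?thesis by (rule zero)
  qed
  then show ?thesis using that[of "e / 2"] e(1) by simp
qed

text \<open>Here \<open>\<xi> / C\<close> lies on the plateau of \<open>\<phi>\<close>, while
  \<open>2 * \<xi> / C\<close> is at least \<open>2 - \<epsilon>\<close>, where
  \<open>\<phi>\<close> vanishes.\<close>

lemma dyadic_cutoff_eq_1:
  assumes "is_cutoff \<phi>" "\<And>x. x \<ge> 2 - \<epsilon> \<Longrightarrow> \<phi> x = 0"
    and "C > 1" "(1 - \<epsilon> / 2) * C \<le> \<xi>" "0 \<le> \<xi>" "\<xi> \<le> C"
  shows "dyadic_cutoff \<phi> C \<xi> = 1"
proof -
  have "\<phi> (2 * \<bar>\<xi>\<bar> / C) = 0" using assms(3-) by (intro assms(2)) (simp add: field_simps)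
  moreover have "\<phi> (\<bar>\<xi>\<bar> / C) = 1"
    using assms(1,3-) by (auto simp: is_cutoff_def divide_simps)
  ultimately show ?thesis using assms(3) by (simp add: dyadic_cutoff_def)
qed

section \<open>Lattice cubes and the slabs over them\<close>

text \<open>Coordinate \<open>i0\<close> is frozen at 0, to be filled in by
  \<open>slab_point\<close>; the cube has dimension \<open>CARD('n) - 1\<close>.\<close>

definition lattice_box :: "'n \<Rightarrow> nat \<Rightarrow> (int ^ 'n) set" where
  "lattice_box i0 M = {v. v $ i0 = 0 \<and> (\<forall>j. v $ j \<in> {0..int M})}"

lemma lattice_box_eq_image:
  "lattice_box i0 M = vec_lambda ` PiE UNIV (\<lambda>j. if j = i0 then {0} else {0..int M})"
proof (intro equalityI subsetI)
  fix v assume "v \<in> lattice_box i0 M"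
  then have "vec_nth v \<in> PiE UNIV (\<lambda>j. if j = i0 then {0} else {0..int M})"
    by (auto simp: lattice_box_def split: if_splits)
  then show "v \<in> vec_lambda ` PiE UNIV (\<lambda>j. if j = i0 then {0} else {0..int M})"
    by (metis image_eqI vec_nth_inverse)
next
  fix v assume "v \<in> vec_lambda ` PiE UNIV (\<lambda>j. if j = i0 then {0} else {0..int M})"
  then obtain f where f: "v = vec_lambda f" "\<And>j. f j \<in> (if j = i0 then {0} else {0..int M})"
    by auto
  have "0 \<le> f j" "f j \<le> int M" "f i0 = 0" for j
    using f(2)[of j] f(2)[of i0] by (auto split: if_splits)
  then show "v \<in> lattice_box i0 M" by (simp add: lattice_box_def f(1))
qed

lemma finite_lattice_box: "finite (lattice_box i0 M)"
  unfolding lattice_box_eq_image by (intro finite_imageI finite_PiE) auto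

lemma card_lattice_box: "card (lattice_box (i0 :: 'n :: finite) M) = (M + 1) ^ (CARD('n) - 1)"
proof -
  have "card (lattice_box i0 M) = (\<Prod>j\<in>UNIV. card (if j = i0 then {0} else {0..int M}))"
    unfolding lattice_box_eq_image
    by (subst card_image) (auto intro!: inj_onI simp: card_PiE vec_lambda_inject)
  also have "\<dots> = (\<Prod>j\<in>UNIV - {i0}. M + 1)"
    by (subst prod.remove[of _ i0]) (auto intro!: prod.cong simp: nat_add_distrib)
  finally show ?thesis by (simp add: card_Diff_singleton)
qed

lemma sum_in_lattice_box:
  assumes "\<And>i. i < m \<Longrightarrow> v i \<in> lattice_box i0 M"
  shows "(\<Sum>i<m. v i) \<in> lattice_box i0 (m * M)"
proof -
  have "0 \<le> (\<Sum>i<m. v i $ j)" for j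
    using assms by (intro sum_nonneg) (auto simp: lattice_box_def)
  moreover have "(\<Sum>i<m. v i $ j) \<le> int (m * M)" for j
    using assms sum_bounded_above[of "{..<m}" "\<lambda>i. v i $ j" "int M"] by (auto simp: lattice_box_def)
  moreover have "(\<Sum>i<m. v i $ i0) = 0"
    using assms by (auto simp: lattice_box_def intro!: sum.neutral)
  ultimately show ?thesis by (auto simp: lattice_box_def)
qed

text \<open>The \<open>i0\<close>-coordinate is chosen so that the frequency falls into
  \<open>[N \<omega>\<^bsub>i0\<^esub>, (N + 1) \<omega>\<^bsub>i0\<^esub>)\<close>.\<close>

definition slab_point :: "real ^ 'n \<Rightarrow> 'n \<Rightarrow> int \<Rightarrow> int ^ 'n \<Rightarrow> int ^ 'n" where
  "slab_point \<omega> i0 N v = v + axis i0 (N - \<lfloor>freq \<omega> v / \<omega> $ i0\<rfloor>)"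

definition slab :: "real ^ 'n \<Rightarrow> 'n \<Rightarrow> int \<Rightarrow> nat \<Rightarrow> (int ^ 'n) set" where
  "slab \<omega> i0 N M = slab_point \<omega> i0 N ` lattice_box i0 M"

lemma finite_slab: "finite (slab \<omega> i0 N M)"
  by (simp add: slab_def finite_lattice_box)

text \<open>\<open>slab_point\<close> changes only coordinate \<open>i0\<close>, which is 0
  throughout the box, so distinct base points stay distinct.\<close>

lemma card_slab: "card (slab \<omega> (i0 :: 'n :: finite) N M) = (M + 1) ^ (CARD('n) - 1)"
proof -
  have "inj_on (slab_point \<omega> i0 N) (lattice_box i0 M)"
  proof (rule inj_onI)
    fix u v assume u: "u \<in> lattice_box i0 M" and v: "v \<in> lattice_box i0 M"
      and eq: "slab_point \<omega> i0 N u = slab_point \<omega> i0 N v"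
    have "u $ j = v $ j" for j
    proof (cases "j = i0")
      case True
      then show ?thesis using u v by (auto simp: lattice_box_def)
    next
      case False
      then show ?thesis using arg_cong[OF eq, of "\<lambda>w. w $ j"] by (simp add: slab_point_def axis_def)
    qed
    then show "u = v" by (simp add: vec_eq_iff)
  qed
  then show ?thesis by (simp add: slab_def card_image card_lattice_box)
qed

text \<open>The floor in \<open>slab_point\<close> removes the integer part, so \<open>v\<close>
  enters only through a fractional part.\<close>

lemma freq_slab_point:
  assumes "\<omega> $ i0 \<noteq> 0"
  shows "freq \<omega> (slab_point \<omega> i0 N v) = \<omega> $ i0 * (of_int N + frac (freq \<omega> v / \<omega> $ i0))"
  using assms by (simp add: slab_point_def freq_add freq_axis frac_def field_simps)

lemma freq_slab:
  assumes "\<omega> $ i0 > 0" "\<omega> $ i0 \<le> 1" "n \<in> slab \<omega> i0 N M"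
  shows "\<bar>freq \<omega> n - \<omega> $ i0 * (of_int N + 1 / 2)\<bar> \<le> 1 / 2"
proof -
  from assms(3) obtain v where n: "n = slab_point \<omega> i0 N v" by (auto simp: slab_def)
  define y where "y = frac (freq \<omega> v / \<omega> $ i0)"
  have y: "0 \<le> y" "y < 1" by (auto simp: y_def frac_lt_1)
  have "freq \<omega> n - \<omega> $ i0 * (of_int N + 1 / 2) = \<omega> $ i0 * (y - 1 / 2)"
    using assms by (simp add: n freq_slab_point y_def algebra_simps)
  also have "\<bar>\<dots>\<bar> = \<omega> $ i0 * \<bar>y - 1 / 2\<bar>" using assms by (simp add: abs_mult)
  also have "\<dots> \<le> 1 * (1 / 2)" using y assms by (intro mult_mono) (auto simp: abs_if)
  finally show ?thesis by simp
qed

section \<open>The sumset of a slab\<close>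

text \<open>A superset of the \<open>m\<close>-fold sums of slab frequencies; \<open>k\<close>
  records the carry that arises because floors are not additive.\<close>

definition slab_sums :: "real ^ 'n \<Rightarrow> 'n \<Rightarrow> int \<Rightarrow> nat \<Rightarrow> nat \<Rightarrow> real set" where
  "slab_sums \<omega> i0 N M m =
     (\<lambda>(v, k). freq \<omega> (slab_point \<omega> i0 (int m * N + k) v)) ` (lattice_box i0 (m * M) \<times> {0..int m})"

lemma finite_slab_sums: "finite (slab_sums \<omega> i0 N M m)"
  by (simp add: slab_sums_def finite_lattice_box)

lemma card_slab_sums:
  "card (slab_sums \<omega> (i0 :: 'n :: finite) N M m) \<le> (m * M + 1) ^ (CARD('n) - 1) * (m + 1)"
proof -
  have "card (slab_sums \<omega> i0 N M m) \<le> card (lattice_box i0 (m * M) \<times> {0..int m})"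
    unfolding slab_sums_def by (rule card_image_le) (simp add: finite_lattice_box)
  then show ?thesis by (simp add: card_cartesian_product card_lattice_box nat_add_distrib)
qed

text \<open>Base points add up inside a box enlarged by the factor \<open>m\<close>, and the floor
  of a sum exceeds the sum of the \<open>m\<close> floors by at most \<open>m\<close>. For fixed
  \<open>m\<close> and dimension the sumset is thus only a constant factor larger than the
  slab.\<close>

lemma sum_freq_slab:
  assumes "\<omega> $ i0 > 0" "\<And>i. i < m \<Longrightarrow> g i \<in> slab \<omega> i0 N M"
  shows "(\<Sum>i<m. freq \<omega> (g i)) \<in> slab_sums \<omega> i0 N M m"
proof -
  have "\<forall>i. \<exists>v. i < m \<longrightarrow> v \<in> lattice_box i0 M \<and> g i = slab_point \<omega> i0 N v"
    using assms(2) by (auto simp: slab_def image_iff Bex_def)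
  then obtain v where v: "\<And>i. i < m \<Longrightarrow> v i \<in> lattice_box i0 M" "\<And>i. i < m \<Longrightarrow> g i = slab_point \<omega> i0 N (v i)"
    by metis
  define x where "x i = freq \<omega> (v i) / \<omega> $ i0" for i
  define V where "V = (\<Sum>i<m. v i)"
  \<comment> \<open>This is the floor of the sum of the fractional parts of the
    \<open>x i\<close>.\<close>
  define k where "k = \<lfloor>\<Sum>i<m. x i\<rfloor> - (\<Sum>i<m. \<lfloor>x i\<rfloor>)"
  have V: "freq \<omega> V / \<omega> $ i0 = (\<Sum>i<m. x i)"
    by (simp add: V_def freq_sum x_def sum_divide_distrib)
  have "(\<Sum>i<m. of_int \<lfloor>x i\<rfloor>) \<le> (\<Sum>i<m. x i)" by (intro sum_mono) auto
  then have "k \<ge> 0" unfolding k_def by (simp add: le_floor_iff)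
  moreover have "(\<Sum>i<m. x i) \<le> (\<Sum>i<m. of_int \<lfloor>x i\<rfloor> + 1)" by (intro sum_mono) linarith
  then have "(\<Sum>i<m. x i) \<le> of_int ((\<Sum>i<m. \<lfloor>x i\<rfloor>) + int m)" by (simp add: sum.distrib)
  then have "k \<le> int m" unfolding k_def by linarith
  moreover have "(\<Sum>i<m. freq \<omega> (g i)) = freq \<omega> (slab_point \<omega> i0 (int m * N + k) V)"
  proof -
    have "(\<Sum>i<m. freq \<omega> (g i)) = (\<Sum>i<m. freq \<omega> (slab_point \<omega> i0 N (v i)))"
      using v(2) by (intro sum.cong) auto
    also have "\<dots> = (\<Sum>i<m. \<omega> $ i0 * (of_int N + (x i - of_int \<lfloor>x i\<rfloor>)))"
      using assms(1) by (simp add: freq_slab_point x_def frac_def)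
    also have "\<dots> = \<omega> $ i0 * (of_int (int m * N) + ((\<Sum>i<m. x i) - of_int (\<Sum>i<m. \<lfloor>x i\<rfloor>)))"
      by (simp add: sum.distrib sum_subtractf flip: sum_distrib_left)
    also have "\<dots> = freq \<omega> (slab_point \<omega> i0 (int m * N + k) V)"
      using assms(1) by (simp add: freq_slab_point V frac_def k_def)
    finally show ?thesis .
  qed
  moreover have "V \<in> lattice_box i0 (m * M)" unfolding V_def using v(1) by (rule sum_in_lattice_box)
  ultimately show ?thesis unfolding slab_sums_def by (auto intro!: image_eqI[of _ _ "(V, k)"])
qed

section \<open>Euclidean length of slab points\<close>

text \<open>Coordinate \<open>i0\<close> equals \<open>N - k\<close> with
  \<open>0 \<le> k \<le> 2 * CARD('n) * M\<close>. The \<open>CARD('n) * M\<close> subtracted in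
  \<open>N\<close> pays for the other coordinates in the upper bound; together with the range of
  \<open>k\<close> it costs \<open>3 * CARD('n) * M\<close> in the lower bound.\<close>

lemma lattice_norm_slab:
  fixes i0 :: "'n :: finite"
  assumes \<omega>: "\<And>i. \<omega> $ i \<in> {1/2<..1}"
    and N: "N = Q * int M - int (CARD('n) * M)" and Q: "Q \<ge> 3 * int CARD('n)"
    and n: "n \<in> slab \<omega> i0 N M"
  shows "lattice_norm n \<in> {of_int ((Q - 3 * int CARD('n)) * int M)..of_int (Q * int M)}"
proof -
  from n obtain v where v: "v \<in> lattice_box i0 M" and n: "n = slab_point \<omega> i0 N v" by (auto simp: slab_def)
  define k where "k = \<lfloor>freq \<omega> v / \<omega> $ i0\<rfloor>"
  have v0: "0 \<le> v $ j" "v $ j \<le> int M" for j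
    using v by (auto simp: lattice_box_def)
  have \<omega>': "0 \<le> \<omega> $ j" "\<omega> $ j \<le> 1" "\<omega> $ j > 1 / 2" for j using \<omega>[of j] by auto
  have "0 \<le> freq \<omega> v" unfolding freq_def using v0 \<omega>' by (intro sum_nonneg) auto
  then have k0: "k \<ge> 0" unfolding k_def using \<omega>'[of i0] by simp
  have "freq \<omega> v \<le> (\<Sum>j\<in>(UNIV :: 'n set). real M * 1)"
    unfolding freq_def
  proof (intro sum_mono mult_mono)
    fix j show "real_of_int (v $ j) \<le> real M" using v0[of j] by linarith
  qed (use \<omega>' in auto)
  then have "freq \<omega> v \<le> real (CARD('n) * M)" by simp
  \<comment> \<open>The factor 2 comes from \<open>\<omega> $ i0 > 1 / 2\<close>.\<close>
  also have "\<dots> \<le> real (2 * CARD('n) * M) * \<omega> $ i0"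
    using mult_left_mono[of "1 / 2" "\<omega> $ i0" "real (2 * CARD('n) * M)"] \<omega>'(3)[of i0] by simp
  finally have "freq \<omega> v / \<omega> $ i0 \<le> real (2 * CARD('n) * M)"
    using \<omega>'(3)[of i0] by (simp add: pos_divide_le_eq)
  then have "k \<le> int (2 * CARD('n) * M)" unfolding k_def by linarith
  then have k1: "k \<le> 2 * int CARD('n) * int M" by simp
  have n0: "n $ i0 = N - k" using v by (auto simp: n slab_point_def k_def lattice_box_def)
  have nj: "n $ j = v $ j" if "j \<noteq> i0" for j using that by (simp add: n slab_point_def axis_def)
  have lo: "(Q - 3 * int CARD('n)) * int M \<le> n $ i0"
    using k1 by (simp add: n0 N algebra_simps)
  have "0 \<le> (Q - 3 * int CARD('n)) * int M" using Q by simp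
  then have pos: "0 \<le> n $ i0" using lo by linarith
  have "real_of_int ((Q - 3 * int CARD('n)) * int M) \<le> real_of_int \<bar>n $ i0\<bar>"
    using lo by linarith
  also have "\<dots> \<le> lattice_norm n"
    using component_le_norm_cart[of "(\<chi> i. of_int (n $ i)) :: real ^ 'n" i0]
    by (simp add: lattice_norm_def)
  finally have lower: "real_of_int ((Q - 3 * int CARD('n)) * int M) \<le> lattice_norm n" .
  have "lattice_norm n \<le> (\<Sum>j\<in>UNIV. real_of_int \<bar>n $ j\<bar>)"
    using norm_le_l1_cart[of "(\<chi> i. of_int (n $ i)) :: real ^ 'n"] by (simp add: lattice_norm_def)
  also have "\<dots> = of_int (\<Sum>j\<in>UNIV. \<bar>n $ j\<bar>)" by simp
  also have "(\<Sum>j\<in>UNIV. \<bar>n $ j\<bar>) = n $ i0 + (\<Sum>j\<in>UNIV - {i0}. \<bar>n $ j\<bar>)"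
    using pos by (subst sum.remove[of _ i0]) auto
  also have "(\<Sum>j\<in>UNIV - {i0}. \<bar>n $ j\<bar>) \<le> (\<Sum>j\<in>UNIV - {i0}. int M)"
    using v0 nj by (intro sum_mono) auto
  also have "\<dots> \<le> (\<Sum>j\<in>(UNIV :: 'n set). int M)" by (intro sum_mono2) auto
  also have "n $ i0 + \<dots> \<le> Q * int M" using k0 by (simp add: n0 N)
  finally have "lattice_norm n \<le> of_int (Q * int M)" by simp
  with lower show ?thesis by simp
qed

section \<open>Growth in \<open>C\<close> and the contradiction\<close>

lemma geometric_unbounded:
  fixes e B :: real
  assumes "e > 0"
  obtains k :: nat where "(2 ^ k) powr e > B"
proof -
  have "2 powr e > 1" using assms by simp
  then obtain k where "B < (2 powr e) ^ k" using real_arch_pow by blast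
  also have "(2 powr e) ^ k = (2 ^ k) powr e"
    by (simp add: powr_powr mult.commute flip: powr_realpow)
  finally show ?thesis by (rule that)
qed

text \<open>The estimate is tested at \<open>C = 2 ^ (r + k)\<close> on the indicator of a slab over
  a box of side \<open>2 ^ k\<close>. The shift \<open>r\<close>, and with it \<open>B\<close>, is
  independent of \<open>k\<close>.\<close>

lemma estimate_imp_power_bound:
  fixes \<omega> :: "real ^ 'n" and K s :: real
  assumes \<omega>: "\<And>i. \<omega> $ i \<in> {1/2<..1}" and res: "nonresonant \<omega>" and \<phi>: "is_cutoff \<phi>"
    and m: "m \<noteq> 0" "m \<le> 3"
    and bound: "\<And>k a. finite {n. a n \<noteq> 0} \<Longrightarrow>
       spacetime_norm (2 * real m) (\<lambda>t. trig_poly \<omega> (schroedinger \<omega> t (dyadic_proj \<phi> (2 ^ k) a)))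
         \<le> K * (2 ^ k) powr s * mean_Lp_norm 2 (trig_poly \<omega> a)"
  obtains B where "\<And>k. real ((2 ^ k + 1) ^ (CARD('n) - 1)) ^ (m - 1) \<le> B * (2 ^ k) powr (s * (2 * real m))"
proof -
  define d where "d = CARD('n) - 1"
  define p where "p = 2 * real m"
  obtain i0 :: 'n where True by blast
  obtain \<epsilon> where \<epsilon>: "\<epsilon> > 0" "\<And>x. x \<ge> 2 - \<epsilon> \<Longrightarrow> \<phi> x = 0"
    using is_cutoff_vanishes_near_2[OF \<phi>] by blast
  \<comment> \<open>The three terms ensure \<open>C > 1\<close>, the hypothesis on \<open>Q\<close>
    for \<open>Q = 2 ^ r\<close>, and that a shell of thickness \<open>3 * CARD('n) * M\<close> fits
    into \<open>\<epsilon> / 2 * C\<close>.\<close>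
  define R where "R = max (max 1 (3 * real CARD('n))) (6 * real CARD('n) / \<epsilon>)"
  obtain r where "R < 2 ^ r"
    using real_arch_pow[of 2 R] by auto
  then have r: "(2::real) ^ r > 1" "(2::real) ^ r > 3 * real CARD('n)" "6 * real CARD('n) < 2 ^ r * \<epsilon>"
    using \<epsilon>(1) by (auto simp: R_def pos_divide_less_eq)
  \<comment> \<open>Collected here are the 1/4 of the lower bound, the sumset factor, and the
    constants of the assumed estimate, including the share \<open>2 ^ r\<close> of
    \<open>C\<close>.\<close>
  define B where "B = 4 * (real (m + 1) * real m ^ d) * (\<bar>K\<bar> powr p * (2 ^ r) powr (s * p))"
  have "real ((2 ^ k + 1) ^ d) ^ (m - 1) \<le> B * (2 ^ k) powr (s * p)" for k
  proof -
    define M :: nat where "M = 2 ^ k"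
    \<comment> \<open>With \<open>Q = 2 ^ r\<close>, the outer radius \<open>Q * M\<close> from
      \<open>lattice_norm_slab\<close> is exactly \<open>C\<close>.\<close>
    define N where "N = 2 ^ r * int M - int (CARD('n) * M)"
    define A where "A = slab \<omega> i0 N M"
    define X where "X = real ((M + 1) ^ d)"
    define C :: real where "C = 2 ^ (r + k)"
    define a :: "int ^ 'n \<Rightarrow> complex" where "a n = of_bool (n \<in> A)" for n
    define st where "st = spacetime_norm p (\<lambda>t. trig_poly \<omega> (schroedinger \<omega> t a))"
    have finA: "finite A" unfolding A_def by (rule finite_slab)
    have cardA: "real (card A) = X" by (simp add: A_def X_def card_slab d_def)
    have X: "X > 0" by (simp add: X_def)
    have C1: "C > 1"
      using r(1) one_le_power[of "2::real" k] unfolding C_def power_add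
      by (intro less_le_trans[OF r(1)]) (simp add: mult_le_cancel_left1)
    have "dyadic_cutoff \<phi> C (lattice_norm n) = 1" if "n \<in> A" for n
    proof (rule dyadic_cutoff_eq_1[OF \<phi> \<epsilon>(2) C1])
      have "real_of_int (3 * int CARD('n)) \<le> real_of_int (2 ^ r)" using r(2) by simp
      then have "3 * int CARD('n) \<le> 2 ^ r" by (simp only: of_int_le_iff)
      then have ln: "lattice_norm n \<in> {of_int ((2 ^ r - 3 * int CARD('n)) * int M)..of_int (2 ^ r * int M)}"
        using that by (intro lattice_norm_slab[OF \<omega> N_def]) (auto simp: A_def)
      then show "lattice_norm n \<le> C" by (simp add: C_def M_def power_add)
      show "0 \<le> lattice_norm n" by (simp add: lattice_norm_def)
      have "(1 - \<epsilon> / 2) * C = (2 ^ r - 2 ^ r * \<epsilon> / 2) * real M"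
        by (simp add: C_def M_def power_add algebra_simps)
      also have "\<dots> \<le> (2 ^ r - 3 * real CARD('n)) * real M"
        using r(3) by (intro mult_right_mono) auto
      finally show "(1 - \<epsilon> / 2) * C \<le> lattice_norm n" using ln by simp
    qed
    then have proj: "dyadic_proj \<phi> C a = a" by (auto simp: dyadic_proj_def a_def)
    have "finite {n. a n \<noteq> 0}" by (rule finite_subset[OF _ finA]) (auto simp: a_def)
    then have "st \<le> K * C powr s * mean_Lp_norm 2 (trig_poly \<omega> a)"
      using bound[of a "r + k"] proj unfolding st_def p_def C_def by simp
    \<comment> \<open>\<open>K\<close> may be negative; the absolute value gives nonnegative
      factors, over which the power \<open>p\<close> is then distributed.\<close>
    also have "\<dots> \<le> \<bar>K\<bar> * C powr s * mean_Lp_norm 2 (trig_poly \<omega> a)"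
      by (intro mult_right_mono) (auto simp: mean_Lp_norm_def)
    finally have "st powr p \<le> (\<bar>K\<bar> * C powr s * mean_Lp_norm 2 (trig_poly \<omega> a)) powr p"
      by (intro powr_mono2) (auto simp: st_def spacetime_norm_def p_def)
    also have "mean_Lp_norm 2 (trig_poly \<omega> a) \<ge> 0" by (simp add: mean_Lp_norm_def)
    then have "(\<bar>K\<bar> * C powr s * mean_Lp_norm 2 (trig_poly \<omega> a)) powr p =
        \<bar>K\<bar> powr p * C powr (s * p) * (mean_Lp_norm 2 (trig_poly \<omega> a) powr 2) powr m"
      by (simp add: powr_mult powr_powr p_def del: powr_numeral)
    also have "mean_Lp_norm 2 (trig_poly \<omega> a) powr 2 = X"
      using mean_L2_norm_indicator[OF res finA] cardA unfolding a_def by simp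
    also have "X powr m = X ^ m" using X by (simp add: powr_realpow)
    finally have upper: "st powr p \<le> \<bar>K\<bar> powr p * C powr (s * p) * X ^ m" .
    have "real (card (slab_sums \<omega> i0 N M m)) \<le> real ((m * M + 1) ^ d * (m + 1))"
      unfolding d_def by (intro of_nat_mono card_slab_sums)
    \<comment> \<open>Since \<open>m\<close> is at least 1, the 1 is absorbed into
      \<open>m * (M + 1)\<close>, which exposes the factor \<open>X\<close>.\<close>
    also have "\<dots> \<le> real ((m * (M + 1)) ^ d * (m + 1))"
      using m(1) by (intro of_nat_mono mult_right_mono power_mono) auto
    also have "\<dots> = real (m + 1) * real m ^ d * X" by (simp only: X_def of_nat_mult of_nat_power power_mult_distrib mult_ac)
    finally have cardS: "real (card (slab_sums \<omega> i0 N M m)) \<le> real (m + 1) * real m ^ d * X" .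
    have "X ^ (2 * m) / 4 \<le> real (card (slab_sums \<omega> i0 N M m)) * st powr p"
      unfolding st_def p_def a_def cardA[symmetric]
    proof (rule spacetime_norm_lower[OF finA m])
      show "\<bar>freq \<omega> n - \<omega> $ i0 * (of_int N + 1 / 2)\<bar> \<le> 1 / 2" if "n \<in> A" for n
        using \<omega>[of i0] that by (intro freq_slab) (auto simp: A_def)
      show "(\<Sum>i<m. freq \<omega> (g i)) \<in> slab_sums \<omega> i0 N M m" if "g \<in> PiE {..<m} (\<lambda>_. A)" for g
        using \<omega>[of i0] that by (intro sum_freq_slab) (auto simp: A_def)
    qed (rule finite_slab_sums)
    also have "\<dots> \<le> (real (m + 1) * real m ^ d * X) * (\<bar>K\<bar> powr p * C powr (s * p) * X ^ m)"
      using cardS upper X by (intro mult_mono) auto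
    also have "C = 2 ^ r * 2 ^ k" by (simp add: C_def power_add)
    finally have "X ^ (2 * m) \<le> B * (2 ^ k) powr (s * p) * (X * X ^ m)"
      by (simp add: B_def powr_mult mult_ac)
    \<comment> \<open>The cancelled factor is \<open>X\<close> from the sumset times
      \<open>X ^ m\<close> from the quadratic mean.\<close>
    moreover have "X ^ (2 * m) = X ^ (m - 1) * (X * X ^ m)"
      using m(1) by (cases m) (simp_all add: mult_2 power_add)
    ultimately show ?thesis using X by (simp add: X_def M_def)
  qed
  then show ?thesis unfolding d_def p_def by (rule that)
qed

theorem proposition6p1:
  fixes \<omega> :: "real ^ 'n" and \<phi> :: "real \<Rightarrow> real" and p s :: real
  assumes "\<And>i. \<omega> $ i \<in> {1/2<..1}"
    and "nonresonant \<omega>"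
    and "is_cutoff \<phi>"
    and "p \<in> {4, 6}"
    and "s < (real CARD('n) - 1) * (1/2 - 1/p)"
  shows "\<not> (\<exists>K::real. \<forall>C\<in>range (\<lambda>k::nat. (2::real) ^ k). \<forall>a :: int ^ 'n \<Rightarrow> complex.
            finite {n. a n \<noteq> 0} \<longrightarrow>
            spacetime_norm p (\<lambda>t. trig_poly \<omega> (schroedinger \<omega> t (dyadic_proj \<phi> C a)))
              \<le> K * C powr s * mean_Lp_norm 2 (trig_poly \<omega> a))"
proof
  define d where "d = CARD('n) - 1"
  have d: "real d = real CARD('n) - 1" by (simp add: d_def of_nat_diff)
  obtain m :: nat where m: "m \<noteq> 0" "m \<le> 3" "p = 2 * real m"
  proof (cases "p = 4")
    case True
    then show thesis using that[of 2] by simp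
  next
    case False
    then show thesis using that[of 3] assms(4) by simp
  qed
  \<comment> \<open>The gap between the growth exponents in \<open>2 ^ k\<close> of the two sides of
    the power bound.\<close>
  define e where "e = real (d * (m - 1)) - s * p"
  have "s * p < real d * (1 / 2 - 1 / p) * p"
    using assms(5) m by (intro mult_strict_right_mono) (auto simp: d)
  \<comment> \<open>From \<open>p = 2 * real m\<close>, the product
    \<open>(1 / 2 - 1 / p) * p\<close> is \<open>m - 1\<close>.\<close>
  also have "\<dots> = real (d * (m - 1))" using m by (simp add: of_nat_diff field_simps)
  finally have "e > 0" by (simp add: e_def)
  assume "\<exists>K::real. \<forall>C\<in>range (\<lambda>k::nat. (2::real) ^ k). \<forall>a :: int ^ 'n \<Rightarrow> complex.
            finite {n. a n \<noteq> 0} \<longrightarrow>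
            spacetime_norm p (\<lambda>t. trig_poly \<omega> (schroedinger \<omega> t (dyadic_proj \<phi> C a)))
              \<le> K * C powr s * mean_Lp_norm 2 (trig_poly \<omega> a)"
  then obtain K where K: "\<And>k a. finite {n. a n \<noteq> 0} \<Longrightarrow>
       spacetime_norm (2 * real m) (\<lambda>t. trig_poly \<omega> (schroedinger \<omega> t (dyadic_proj \<phi> (2 ^ k) a)))
         \<le> K * (2 ^ k) powr s * mean_Lp_norm 2 (trig_poly \<omega> a)"
    unfolding m(3) by blast
  obtain B where B: "\<And>k. real ((2 ^ k + 1) ^ d) ^ (m - 1) \<le> B * (2 ^ k) powr (s * p)"
    using estimate_imp_power_bound[OF assms(1-3) m(1,2) K] unfolding d_def m(3) by blast
  obtain k :: nat where k: "(2 ^ k) powr e > B" using geometric_unbounded[OF \<open>e > 0\<close>] .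
  have "B * (2 ^ k) powr (s * p) < (2 ^ k) powr e * (2 ^ k) powr (s * p)"
    using k by (intro mult_strict_right_mono) auto
  also have "\<dots> = (2 ^ k) powr real (d * (m - 1))" by (simp add: e_def flip: powr_add)
  also have "\<dots> = ((2 ^ k) ^ d) ^ (m - 1)" by (subst powr_realpow) (auto simp: power_mult)
  also have "\<dots> \<le> real ((2 ^ k + 1) ^ d) ^ (m - 1)"
    by (simp add: power_mono)
  finally show False using B[of k] by simp
qed

end
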